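(* There exists a polynomial $p$ such that for every formula $F$ provable in $\mathbf{CL5}^-$, if $k$ denotes the size of $F$ (its length), then there exists a $\mathbf{CL5}^-$ proof of $F$ whose size is at most $p(k)$.
   Context: Formulas: built from (non-logical) atoms, taken from a countably infinite set, using $\neg$, $\wedge$, $\vee$, where $\neg$ may be applied only to atoms (no logical constants). A literal is an atom with or without prefix $\neg$. For a compound formula $F$, $\neg F$ abbreviates the De Morgan dual: $\neg\neg P$ is $P$, $\neg(A\wedge B)$ is $\neg A\vee\neg B$, $\neg(A\vee B)$ is $\neg A\wedge\neg B$. Cirquents: for $k\ge 0$, a $k$-ary cirquent is a pair $C=(\mathrm{St},\mathrm{Pl})$ where the pool $\mathrm{Pl}=\langle F_1,\dots,F_k\rangle$ is a sequence of formulas (repetitions allowed; each occurrence is called an oformula) and the structure $\mathrm{St}=\langle\Gamma_1,\dots,\Gamma_m\rangle$, $m\ge 0$, is a sequence of subsets of $\{1,\dots,k\}$ (repetitions allowed; each occurrence is called an ogroup). Ogroup $\Gamma_j$ contains oformula $F_i$ (there is an arc between them) iff $i\in\Gamma_j$. Two oformulas (or ogroups) are adjacent if they are consecutive in the pool (or structure). Merging two adjacent ogroups $\Gamma,\Delta$ means replacing them by the single ogroup $\Gamma\cup\Delta$. Merging two adjacent oformulas $F,G$ into $H$ means replacing them by the single oformula $H$, which is contained in exactly those ogroups that contained $F$ or $G$. The rules of $\mathbf{CL5}^-$ are: (A) Axioms (no premises): the empty cirquent (empty pool and empty structure); and, for any formula $F$, the identity axiom, i.e. the cirquent with pool $\langle\neg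 F,F\rangle$ and structure $\langle\{1,2\}\rangle$. (M) Mix (two premises): the conclusion is obtained by placing the two premises side by side (concatenating pools and structures, keeping arcs). (E) Exchange (one premise): swap two adjacent oformulas (preserving all arcs), or swap two adjacent ogroups (preserving all arcs). (W) Weakening (one premise): ogroup weakening adds one new arc between an existing ogroup and an existing oformula; pool weakening inserts a new oformula (contained in no ogroup) at any position of the pool. ($\vee$) $\vee$-introduction (one premise): merge two adjacent oformulas $F$ and $G$ ($G$ immediately after $F$) into $F\vee G$. ($\wedge$) $\wedge$-introduction (one premise): the premise has adjacent oformulas $F$, $G$ ($G$ immediately after $F$) such that no ogroup contains both, every ogroup containing $F$ is immediately followed by an ogroup containing $G$, and every ogroup containing $G$ is immediately preceded by an ogroup containing $F$; the conclusion is obtained by merging each ogroup containing $F$ with the ogroup containing $G$ that immediately follows it, and then merging $F$ and $G$ into $F\wedge G$. A $\mathbf{CL5}^-$ proof of a cirquent $C$ is a (finite) tree of cirquents with root $C$ in which each node follows from its children by one of the rules above. A proof of a formula $F$ is a proof of the cirquent with pool $\langle F\rangle$ and structure $\langle\{1\}\rangle$; $F$ is provable if it has a proof. Sizes: the length of a formula is the total number of occurrences of literals and connectives in it. The size of an ogroup is the number of oformulas it contains. The size of a cirquent is the sum of the lengths of the oformulas in its pool plus the sum of the sizes of its ogroups. The size of a proof is the sum of the sizes of the cirquents (nodes) it contains. *)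

theory Defs
  imports "HOL-Computational_Algebra.Polynomial" "HOL-Combinatorics.Transposition"
begin

type_synonym atom = nat

datatype formula =
    Pos atom
  | Neg atom
  | Conj formula formula
  | Disj formula formula

primrec negate :: "formula \<Rightarrow> formula" where
  "negate (Pos a) = Neg a"
| "negate (Neg a) = Pos a"
| "negate (Conj A B) = Disj (negate A) (negate B)"
| "negate (Disj A B) = Conj (negate A) (negate B)"

text \<open>A negated atom is a single literal occurrence, so it has length 1.\<close>

primrec formula_length :: "formula \<Rightarrow> nat" where
  "formula_length (Pos a) = 1"
| "formula_length (Neg a) = 1"
| "formula_length (Conj A B) = formula_length A + formula_length B + 1"
| "formula_length (Disj A B) = formula_length A + formula_length B + 1"

text \<open>A cirquent is written as pool and structure, in this order. Positions in the pool are
  counted from 0 (as for list indexing), so an ogroup of a \<open>k\<close>-ary cirquent is a subset of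
  \<open>{..<k}\<close>.\<close>

type_synonym ogroup = "nat set"
type_synonym pool = "formula list"
type_synonym cirquent = "pool \<times> ogroup list"

fun is_cirquent :: "cirquent \<Rightarrow> bool" where
  "is_cirquent (pl, st) \<longleftrightarrow> (\<forall>\<Gamma>\<in>set st. \<Gamma> \<subseteq> {..<length pl})"

fun cirquent_size :: "cirquent \<Rightarrow> nat" where
  "cirquent_size (pl, st) = (\<Sum>F\<leftarrow>pl. formula_length F) + (\<Sum>\<Gamma>\<leftarrow>st. card \<Gamma>)"

text \<open>A rule that changes the pool moves its positions; \<open>reindex\<close> transports the arcs along.\<close>

definition reindex :: "(nat \<Rightarrow> nat) \<Rightarrow> ogroup list \<Rightarrow> ogroup list" where
  "reindex f st = map (\<lambda>\<Gamma>. f ` \<Gamma>) st"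

definition insert_pos :: "nat \<Rightarrow> nat \<Rightarrow> nat" where
  "insert_pos n i = (if i < n then i else Suc i)"

text \<open>Positions \<open>n\<close> and \<open>Suc n\<close> are both sent to \<open>n\<close>.\<close>

definition merge_pos :: "nat \<Rightarrow> nat \<Rightarrow> nat" where
  "merge_pos n i = (if i \<le> n then i else i - 1)"

text \<open>The premise condition of \<open>\<and>\<close>-introduction for the oformulas at positions \<open>n\<close> and
  \<open>Suc n\<close>.\<close>

definition conj_ready :: "nat \<Rightarrow> ogroup list \<Rightarrow> bool" where
  "conj_ready n st \<longleftrightarrow>
     (\<forall>j<length st. \<not> (n \<in> st ! j \<and> Suc n \<in> st ! j)) \<and>
     (\<forall>j<length st. n \<in> st ! j \<longrightarrow> Suc j < length st \<and> Suc n \<in> st ! Suc j) \<and>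
     (\<forall>j<length st. Suc n \<in> st ! j \<longrightarrow> 0 < j \<and> n \<in> st ! (j - 1))"

text \<open>Merge each ogroup containing position \<open>n\<close> with its immediate successor. Under
  \<open>conj_ready\<close> the pairs to be merged do not overlap and the successor always exists.\<close>

fun merge_ogroups :: "nat \<Rightarrow> ogroup list \<Rightarrow> ogroup list" where
  "merge_ogroups n (\<Gamma> # \<Delta> # st) =
     (if n \<in> \<Gamma> then (\<Gamma> \<union> \<Delta>) # merge_ogroups n st else \<Gamma> # merge_ogroups n (\<Delta> # st))"
| "merge_ogroups n st = st"

text \<open>\<open>CL5_rule Cs C\<close>: the cirquent \<open>C\<close> follows from the list of premises \<open>Cs\<close> by one rule of
  \<open>CL5\<^sup>-\<close>.\<close>

inductive CL5_rule :: "cirquent list \<Rightarrow> cirquent \<Rightarrow> bool" where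
  empty_axiom:
    "CL5_rule [] ([], [])"
| identity_axiom:
    "CL5_rule [] ([negate F, F], [{0, 1}])"
| mix:
    "CL5_rule [(pl1, st1), (pl2, st2)]
       (pl1 @ pl2, st1 @ reindex (\<lambda>i. length pl1 + i) st2)"
| oformula_exchange:
    "CL5_rule [(xs @ [F, G] @ ys, st)]
       (xs @ [G, F] @ ys, reindex (transpose (length xs) (Suc (length xs))) st)"
| ogroup_exchange:
    "CL5_rule [(pl, us @ [\<Gamma>, \<Delta>] @ vs)] (pl, us @ [\<Delta>, \<Gamma>] @ vs)"
| ogroup_weakening:
    "i < length pl \<Longrightarrow> i \<notin> \<Gamma> \<Longrightarrow>
     CL5_rule [(pl, us @ [\<Gamma>] @ vs)] (pl, us @ [insert i \<Gamma>] @ vs)"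
| pool_weakening:
    "CL5_rule [(xs @ ys, st)] (xs @ [F] @ ys, reindex (insert_pos (length xs)) st)"
| disj_intro:
    "CL5_rule [(xs @ [F, G] @ ys, st)]
       (xs @ [Disj F G] @ ys, reindex (merge_pos (length xs)) st)"
| conj_intro:
    "conj_ready (length xs) st \<Longrightarrow>
     CL5_rule [(xs @ [F, G] @ ys, st)]
       (xs @ [Conj F G] @ ys, reindex (merge_pos (length xs)) (merge_ogroups (length xs) st))"

datatype proof_tree = Node (conclusion: cirquent) (children: "proof_tree list")

fun is_CL5_proof :: "proof_tree \<Rightarrow> bool" where
  "is_CL5_proof (Node C ts) \<longleftrightarrow>
     is_cirquent C \<and> CL5_rule (map conclusion ts) C \<and> (\<forall>t\<in>set ts. is_CL5_proof t)"

fun proof_size :: "proof_tree \<Rightarrow> nat" where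
  "proof_size (Node C ts) = cirquent_size C + (\<Sum>t\<leftarrow>ts. proof_size t)"

definition CL5_proof_of :: "proof_tree \<Rightarrow> formula \<Rightarrow> bool" where
  "CL5_proof_of t F \<longleftrightarrow> is_CL5_proof t \<and> conclusion t = ([F], [{0}])"

definition CL5_provable :: "formula \<Rightarrow> bool" where
  "CL5_provable F \<longleftrightarrow> (\<exists>t. CL5_proof_of t F)"

end

theory Submission
  imports Defs
begin

text \<open>Only identity axioms create ogroups, so a provable cirquent has at most as many ogroups
  as identity axioms above it, hence at most as many as the total length \<open>L\<close> of its pool, and
  therefore at most \<open>L\<^sup>2\<close> arcs. Every rule other than exchange and ogroup weakening increases
  \<open>L\<close> or adds the pools of its premises, and ogroup weakening adds an arc; so \<open>L\<^sup>3\<close> plus the number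
  of arcs bounds the number of steps other than exchanges. A block of consecutive exchanges only
  permutes oformulas and ogroups, which sorting achieves with at most \<open>2 L\<^sup>2\<close> exchanges.\<close>

section \<open>Sorting by adjacent transpositions\<close>

inductive adj_swap :: "'a list \<Rightarrow> 'a list \<Rightarrow> bool" where
  "adj_swap (us @ [a, b] @ vs) (us @ [b, a] @ vs)"

lemma adj_swap_Cons: "adj_swap xs ys \<Longrightarrow> adj_swap (z # xs) (z # ys)"
proof (induction rule: adj_swap.induct)
  case (1 us a b vs)
  show ?case using adj_swap.intros[of "z # us"] by simp
qed

lemma adj_swap_relpowp_Cons: "(adj_swap ^^ n) xs ys \<Longrightarrow> (adj_swap ^^ n) (z # xs) (z # ys)"
  by (induction n arbitrary: ys) (auto intro: adj_swap_Cons)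

lemma adj_swap_relpowp_front: "(adj_swap ^^ length us) (us @ x # vs) (x # us @ vs)"
proof (induction us)
  case (Cons u us)
  have "adj_swap (u # x # us @ vs) (x # u # us @ vs)"
    using adj_swap.intros[of "[]"] by simp
  with adj_swap_relpowp_Cons[OF Cons] show ?case by auto
qed simp

lemma adj_swap_mset: "adj_swap xs ys \<Longrightarrow> mset xs = mset ys"
  by (induction rule: adj_swap.induct) simp

text \<open>Selection sort: the first target entry is moved to the front across at most
  \<open>length ys\<close> entries, and the rest is sorted recursively. Working with multisets
  allows repeated entries.\<close>

lemma adj_swap_sort:
  "mset xs = mset ys \<Longrightarrow> \<exists>n \<le> (length ys)\<^sup>2. (adj_swap ^^ n) xs ys"
proof (induction ys arbitrary: xs)
  case (Cons y ys)
  then have "y \<in> set xs" by (metis list.set_intros(1) set_mset_mset)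
  then obtain us vs where xs: "xs = us @ y # vs" by (meson split_list)
  with Cons.prems have m: "mset (us @ vs) = mset ys" by simp
  then obtain n where n: "n \<le> (length ys)\<^sup>2" "(adj_swap ^^ n) (us @ vs) ys"
    using Cons.IH by blast
  have "(adj_swap ^^ (length us + n)) xs (y # ys)"
    unfolding xs relpowp_add
    using adj_swap_relpowp_front adj_swap_relpowp_Cons[OF n(2)] by (rule relcomppI)
  moreover have "length us \<le> length ys" using mset_eq_length[OF m] by simp
  with n(1) have "length us + n \<le> (length (y # ys))\<^sup>2" by (simp add: power2_eq_square)
  ultimately show ?case by blast
qed simp

section \<open>Exchanges\<close>

text \<open>Exchanges get a relation of their own so that blocks of them can be counted with
  \<open>^^\<close> and compared through the transitive closure.\<close>

inductive exchange :: "cirquent \<Rightarrow> cirquent \<Rightarrow> bool" where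
  oformula: "exchange (xs @ [F, G] @ ys, st)
     (xs @ [G, F] @ ys, reindex (transpose (length xs) (Suc (length xs))) st)"
| ogroup: "exchange (pl, us @ [\<Gamma>, \<Delta>] @ vs) (pl, us @ [\<Delta>, \<Gamma>] @ vs)"

lemma exchange_rule: "exchange C D \<Longrightarrow> CL5_rule [C] D"
  by (induction rule: exchange.induct) (rule oformula_exchange ogroup_exchange)+

section \<open>Sizes and positions under exchange\<close>

definition pool_length :: "pool \<Rightarrow> nat" where
  "pool_length pl = (\<Sum>F\<leftarrow>pl. formula_length F)"

definition arcs :: "ogroup list \<Rightarrow> nat" where
  "arcs st = (\<Sum>\<Gamma>\<leftarrow>st. card \<Gamma>)"

lemma cirquent_size_eq: "cirquent_size (pl, st) = pool_length pl + arcs st"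
  by (simp add: pool_length_def arcs_def)

lemma formula_length_pos: "1 \<le> formula_length F"
  by (cases F) auto

lemma length_le_pool_length: "length pl \<le> pool_length pl"
proof (induction pl)
  case (Cons F pl)
  then show ?case using formula_length_pos[of F] by (simp add: pool_length_def)
qed (simp add: pool_length_def)

lemma reindex_subset:
  "f ` {..<m} \<subseteq> {..<n} \<Longrightarrow> \<forall>\<Gamma>\<in>set st. \<Gamma> \<subseteq> {..<m} \<Longrightarrow> \<forall>\<Gamma>\<in>set (reindex f st). \<Gamma> \<subseteq> {..<n}"
  unfolding reindex_def by (auto simp: image_subset_iff)

lemma transpose_Suc_less:
  "Suc k < n \<Longrightarrow> transpose k (Suc k) ` {..<n} \<subseteq> {..<n}"
  by (auto simp: transpose_def)

lemma exchange_is_cirquent: "exchange C D \<Longrightarrow> is_cirquent C \<Longrightarrow> is_cirquent D"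
proof (induction rule: exchange.induct)
  case (oformula xs F G ys st)
  then show ?case
    using reindex_subset[OF transpose_Suc_less[of "length xs" "length (xs @ [F, G] @ ys)"]]
    by simp
qed simp

lemma arcs_reindex_transpose: "arcs (reindex (transpose a b) st) = arcs st"
  by (simp add: arcs_def reindex_def o_def card_image)

lemma exchange_cirquent_size: "exchange C D \<Longrightarrow> cirquent_size D = cirquent_size C"
proof (induction rule: exchange.induct)
  case (oformula xs F G ys st)
  show ?case unfolding cirquent_size_eq arcs_reindex_transpose by (simp add: pool_length_def)
qed simp

text \<open>For a permutation \<open>ls\<close> of the original positions, \<open>pos ls\<close>
  inverts indexing, so \<open>reindex (pos ls) st\<close> attaches the original arcs to where the
  oformulas stand now. Labelling by positions keeps equal formulas with different arcs
  apart.\<close>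

definition pos :: "'a list \<Rightarrow> 'a \<Rightarrow> nat" where
  "pos ls i = length (takeWhile (\<lambda>j. j \<noteq> i) ls)"

lemma pos_Nil [simp]: "pos [] i = 0"
  by (simp add: pos_def)

lemma pos_Cons [simp]: "pos (j # ls) i = (if j = i then 0 else Suc (pos ls i))"
  by (simp add: pos_def)

lemma pos_append: "pos (us @ vs) i = (if i \<in> set us then pos us i else length us + pos vs i)"
  by (induction us) auto

lemma pos_less: "i \<in> set us \<Longrightarrow> pos us i < length us"
  by (induction us) auto

text \<open>If \<open>i\<close> is absent, both positions are the length of the list, which the
  transposition fixes; hence the equation holds for every \<open>i\<close>.\<close>

lemma pos_swap:
  assumes "distinct (us @ [a, b] @ vs)"
  shows "pos (us @ [b, a] @ vs) i =
     transpose (length us) (Suc (length us)) (pos (us @ [a, b] @ vs) i)"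
  using assms pos_less[of i us]
  by (auto simp: pos_append transpose_def)

lemma pos_upt: "i < n \<Longrightarrow> pos [0..<n] i = i"
proof (induction n)
  case (Suc n)
  then show ?case by (cases "i = n") (auto simp: pos_append)
qed simp

lemma reindex_pos_swap:
  assumes "distinct (us @ [a, b] @ vs)"
  shows "reindex (pos (us @ [b, a] @ vs)) st =
     reindex (transpose (length us) (Suc (length us))) (reindex (pos (us @ [a, b] @ vs)) st)"
  using pos_swap[OF assms] by (simp add: reindex_def image_image)

lemma reindex_pos_upt:
  "is_cirquent (pl, st) \<Longrightarrow> reindex (pos [0..<length pl]) st = st"
  unfolding reindex_def by (rule map_idI) (force simp: pos_upt)

section \<open>Configurations reachable by exchanges, and short routes to them\<close>

text \<open>A list \<open>ls\<close> permuting \<open>[0..<n]\<close> records which original oformula stands at each position.\<close>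

lemma exchanges_permute:
  assumes "exchange\<^sup>*\<^sup>* (pl, st) C" and "is_cirquent (pl, st)"
  shows "\<exists>ls. mset ls = mset [0..<length pl] \<and> fst C = map ((!) pl) ls \<and>
     mset (snd C) = mset (reindex (pos ls) st)"
  using assms(1)
proof (induction rule: rtranclp_induct)
  case base
  have "mset (snd (pl, st)) = mset (reindex (pos [0..<length pl]) st)"
    using reindex_pos_upt[OF assms(2)] by simp
  moreover have "fst (pl, st) = map ((!) pl) [0..<length pl]" by (simp add: map_nth)
  ultimately show ?case by blast
next
  case (step C D)
  then obtain ls where ls: "mset ls = mset [0..<length pl]" "fst C = map ((!) pl) ls"
    "mset (snd C) = mset (reindex (pos ls) st)" by blast
  from step.hyps(2) show ?case
  proof cases
    case (oformula xs F G ys st')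
    from ls(2) oformula have "map ((!) pl) ls = xs @ F # G # ys" by simp
    \<comment> \<open>The splitting of the pool is pulled back to the labels: \<open>a\<close> and
      \<open>b\<close> name the original positions of \<open>F\<close> and \<open>G\<close>.\<close>
    then obtain us a b vs where us: "ls = us @ [a, b] @ vs" "map ((!) pl) us = xs"
      "pl ! a = F" "pl ! b = G" "map ((!) pl) vs = ys"
      unfolding map_eq_append_conv map_eq_Cons_conv by auto
    have "distinct ls" using ls(1) by (metis distinct_upt mset_eq_imp_distinct_iff)
    then have eq: "reindex (pos (us @ [b, a] @ vs)) st =
        reindex (transpose (length us) (Suc (length us))) (reindex (pos ls) st)"
      using reindex_pos_swap us(1) by metis
    have "length xs = length us" using us(2) by auto
    \<comment> \<open>Only the multiset of ogroups is known, which suffices because reindexing acts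
      on each ogroup separately.\<close>
    then have "mset (snd D) = mset (reindex (pos (us @ [b, a] @ vs)) st)"
      unfolding eq using ls(3) oformula by (simp add: reindex_def multiset.map_comp)
    moreover have "fst D = map ((!) pl) (us @ [b, a] @ vs)" using oformula us by simp
    moreover have "mset (us @ [b, a] @ vs) = mset [0..<length pl]"
      unfolding ls(1)[symmetric] us(1) by simp
    ultimately show ?thesis by blast
  next
    case (ogroup pl' us \<Gamma> \<Delta> vs)
    then have "mset (snd D) = mset (snd C)" "fst D = fst C" by simp_all
    with ls(2,3) have "fst D = map ((!) pl) ls" "mset (snd D) = mset (reindex (pos ls) st)"
      by simp_all
    with ls(1) show ?thesis by blast
  qed
qed

lemma swap_oformulas:
  "adj_swap ls ls' \<Longrightarrow> distinct ls \<Longrightarrow>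
     exchange (map f ls, reindex (pos ls) st) (map f ls', reindex (pos ls') st)"
proof (induction rule: adj_swap.induct)
  case (1 us a b vs)
  show ?case
    unfolding reindex_pos_swap[OF 1]
    using exchange.oformula[of "map f us" "f a" "f b" "map f vs"] by simp
qed

lemma permute_oformulas:
  "(adj_swap ^^ n) ls ls' \<Longrightarrow> distinct ls \<Longrightarrow>
     (exchange ^^ n) (map f ls, reindex (pos ls) st) (map f ls', reindex (pos ls') st) \<and>
     distinct ls'"
proof (induction n arbitrary: ls')
  case (Suc n)
  then obtain ks where ks: "(adj_swap ^^ n) ls ks" "adj_swap ks ls'" by auto
  from Suc.IH[OF ks(1) Suc.prems(2)] swap_oformulas[OF ks(2)] show ?case
    using adj_swap_mset[OF ks(2)] mset_eq_imp_distinct_iff by auto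
qed simp

lemma permute_ogroups:
  "(adj_swap ^^ n) st st' \<Longrightarrow> (exchange ^^ n) (pl, st) (pl, st')"
proof (induction n arbitrary: st')
  case (Suc n)
  then obtain su where su: "(adj_swap ^^ n) st su" "adj_swap su st'" by auto
  from su(2) have "exchange (pl, su) (pl, st')" by cases (metis exchange.ogroup)
  with Suc.IH[OF su(1)] show ?case by auto
qed simp

text \<open>A block of any length is replaced by a sorted route: first the pool is brought into its
  final order, dragging the arcs along, then the ogroups are sorted. Each phase costs at most a
  square.\<close>

lemma exchanges_bounded:
  assumes "exchange\<^sup>*\<^sup>* (pl, st) C" and "is_cirquent (pl, st)"
  shows "\<exists>n \<le> (length pl)\<^sup>2 + (length st)\<^sup>2. (exchange ^^ n) (pl, st) C"
proof -
  obtain ls where ls: "mset ls = mset [0..<length pl]" "fst C = map ((!) pl) ls"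
    "mset (snd C) = mset (reindex (pos ls) st)"
    using exchanges_permute[OF assms] by blast
  have len: "length ls = length pl" using mset_eq_length[OF ls(1)] by simp
  obtain m where m: "m \<le> (length pl)\<^sup>2" "(adj_swap ^^ m) [0..<length pl] ls"
    using adj_swap_sort[OF ls(1)[symmetric]] len by auto
  have "(exchange ^^ m) (pl, st) (map ((!) pl) ls, reindex (pos ls) st)"
    using permute_oformulas[OF m(2), of "(!) pl" st] reindex_pos_upt[OF assms(2)]
    by (simp add: map_nth)
  moreover
  have "length (snd C) = length st" using mset_eq_length[OF ls(3)] by (simp add: reindex_def)
  then obtain k where k: "k \<le> (length st)\<^sup>2" "(adj_swap ^^ k) (reindex (pos ls) st) (snd C)"
    using adj_swap_sort[OF ls(3)[symmetric]] by auto
  have "(exchange ^^ k) (map ((!) pl) ls, reindex (pos ls) st) C"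
    using permute_ogroups[OF k(2)] ls(2) by (metis prod.collapse)
  ultimately have "(exchange ^^ (m + k)) (pl, st) C"
    unfolding relpowp_add by blast
  with m(1) k(1) show ?thesis by (meson add_mono)
qed

section \<open>Proofs of bounded size\<close>

definition provable_within :: "nat \<Rightarrow> cirquent \<Rightarrow> bool" where
  "provable_within n C \<longleftrightarrow> (\<exists>t. is_CL5_proof t \<and> conclusion t = C \<and> proof_size t \<le> n)"

lemma provable_within_mono: "provable_within m C \<Longrightarrow> m \<le> n \<Longrightarrow> provable_within n C"
  unfolding provable_within_def using order_trans by blast

lemma provable_within_axiom:
  "CL5_rule [] C \<Longrightarrow> is_cirquent C \<Longrightarrow> provable_within (cirquent_size C) C"
  unfolding provable_within_def by (rule exI[of _ "Node C []"]) simp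

lemma provable_within_rule:
  assumes "CL5_rule [C] D" "is_cirquent D" "provable_within n C"
  shows "provable_within (n + cirquent_size D) D"
proof -
  obtain t where "is_CL5_proof t" "conclusion t = C" "proof_size t \<le> n"
    using assms(3) by (auto simp: provable_within_def)
  then show ?thesis
    unfolding provable_within_def using assms by (intro exI[of _ "Node D [t]"]) simp
qed

lemma provable_within_mix:
  assumes "CL5_rule [C1, C2] D" "is_cirquent D" "provable_within m C1" "provable_within n C2"
  shows "provable_within (m + n + cirquent_size D) D"
proof -
  obtain t u where "is_CL5_proof t" "conclusion t = C1" "proof_size t \<le> m"
     "is_CL5_proof u" "conclusion u = C2" "proof_size u \<le> n"
    using assms(3,4) by (auto simp: provable_within_def)
  then show ?thesis
    unfolding provable_within_def using assms by (intro exI[of _ "Node D [t, u]"]) simp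
qed

text \<open>Exchanges preserve the size of a cirquent, so each of the \<open>k\<close> new nodes
  costs the same.\<close>

lemma provable_within_exchanges:
  "(exchange ^^ k) C D \<Longrightarrow> is_cirquent C \<Longrightarrow> provable_within n C \<Longrightarrow>
     provable_within (n + k * cirquent_size C) D \<and> is_cirquent D \<and>
     cirquent_size D = cirquent_size C"
proof (induction k arbitrary: D)
  case (Suc k)
  then obtain E where E: "(exchange ^^ k) C E" "exchange E D" by auto
  have IH: "provable_within (n + k * cirquent_size C) E" "is_cirquent E"
    "cirquent_size E = cirquent_size C"
    using Suc.IH[OF E(1) Suc.prems(2,3)] by auto
  have "is_cirquent D" "cirquent_size D = cirquent_size E"
    using exchange_is_cirquent[OF E(2) IH(2)] exchange_cirquent_size[OF E(2)] by auto
  then show ?case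
    using provable_within_rule[OF exchange_rule[OF E(2)] _ IH(1)] IH(3)
    by (simp add: algebra_simps)
qed simp

section \<open>The size budget and the induction invariant\<close>

lemma arcs_le:
  assumes "is_cirquent (pl, st)"
  shows "arcs st \<le> length st * length pl"
proof -
  have "\<forall>\<Gamma>\<in>set st. card \<Gamma> \<le> length pl"
    using assms card_mono[of "{..<length pl}"] by fastforce
  then show ?thesis
    unfolding arcs_def by (induction st) auto
qed

text \<open>\<open>block_bound L\<close> bounds the total size of a node and of a minimal block of exchanges below it.\<close>

definition block_bound :: "nat \<Rightarrow> nat" where
  "block_bound L = (1 + 2 * L\<^sup>2) * (L + L\<^sup>2)"

text \<open>The first factor is a rank that strictly grows along every non-exchange step that adds a
  node to the rebuilt proof; each unit of rank pays for one block.\<close>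

definition size_bound :: "cirquent \<Rightarrow> nat" where
  "size_bound C = (pool_length (fst C) ^ 3 + arcs (snd C) + 1) * block_bound (pool_length (fst C))"

text \<open>The quantification over exchange-equivalent cirquents makes exchange steps cost nothing in
  the induction over proofs.\<close>

definition tame :: "cirquent \<Rightarrow> bool" where
  "tame C \<longleftrightarrow> is_cirquent C \<and> length (snd C) \<le> pool_length (fst C) \<and>
     (\<forall>D. exchange\<^sup>*\<^sup>* C D \<longrightarrow> provable_within (size_bound C) D)"

lemma block_bound_mono: "L \<le> M \<Longrightarrow> block_bound L \<le> block_bound M"
  unfolding block_bound_def by (intro mult_mono add_mono power_mono) auto

lemma tame_arcs_le: "tame (pl, st) \<Longrightarrow> arcs st \<le> (pool_length pl)\<^sup>2"
  using arcs_le[of pl st] length_le_pool_length[of pl] mult_mono[of "length st" "pool_length pl" "length pl" "pool_length pl"]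
  by (auto simp: tame_def power2_eq_square)

lemma tame_provable: "tame C \<Longrightarrow> provable_within (size_bound C) C"
  unfolding tame_def by blast

text \<open>Whatever is reachable from \<open>D\<close> is reachable from \<open>C\<close>, and both
  have the same budget, so the exchange is absorbed without adding a node here.\<close>

lemma tame_exchange: "exchange C D \<Longrightarrow> tame C \<Longrightarrow> tame D"
proof -
  assume ex: "exchange C D" and tame: "tame C"
  then have "size_bound D = size_bound C" "pool_length (fst D) = pool_length (fst C)"
    "length (snd D) = length (snd C)"
    by (auto elim!: exchange.cases simp: size_bound_def arcs_reindex_transpose)
      (auto simp: pool_length_def arcs_def reindex_def add_ac)
  with tame show "tame D"
    using exchange_is_cirquent[OF ex] converse_rtranclp_into_rtranclp[of exchange, OF ex]
    unfolding tame_def by metis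
qed

text \<open>Here \<open>n\<close> is what the premises cost. One further \<open>block_bound\<close>
  covers the new node together with the exchanges leading to any equivalent cirquent.\<close>

lemma tameI:
  assumes C: "is_cirquent (pl, st)" and st: "length st \<le> pool_length pl"
    and "provable_within (n + cirquent_size (pl, st)) (pl, st)"
    and n: "n + block_bound (pool_length pl) \<le> size_bound (pl, st)"
  shows "tame (pl, st)"
proof -
  let ?L = "pool_length pl"
  have "provable_within (size_bound (pl, st)) D" if D: "exchange\<^sup>*\<^sup>* (pl, st) D" for D
  proof -
    obtain k where k: "k \<le> (length pl)\<^sup>2 + (length st)\<^sup>2" "(exchange ^^ k) (pl, st) D"
      using exchanges_bounded[OF D C] by blast
    have "arcs st \<le> ?L\<^sup>2"
      using order_trans[OF arcs_le[OF C] mult_mono[OF st length_le_pool_length]]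
      by (simp add: power2_eq_square)
    then have s: "cirquent_size (pl, st) \<le> ?L + ?L\<^sup>2" unfolding cirquent_size_eq by simp
    \<comment> \<open>Pool and structure both have at most \<open>?L\<close> entries, whence the
      factor \<open>1 + 2 * L^2\<close> in \<open>block_bound\<close>; the factor
      \<open>L + L^2\<close> bounds the size of each node.\<close>
    have "k \<le> 2 * ?L\<^sup>2"
      using k(1) power_mono[OF length_le_pool_length[of pl], of 2] power_mono[OF st, of 2]
      by linarith
    with s have "(1 + k) * cirquent_size (pl, st) \<le> block_bound ?L"
      unfolding block_bound_def by (intro mult_mono) auto
    then have "n + cirquent_size (pl, st) + k * cirquent_size (pl, st) \<le> size_bound (pl, st)"
      using n by simp
    with provable_within_exchanges[OF k(2) C assms(3)] show ?thesis
      using provable_within_mono by blast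
  qed
  with C st show ?thesis by (simp add: tame_def)
qed

section \<open>Preservation of tameness by the other rules\<close>

lemma tame_pool_growth:
  assumes "CL5_rule [(pl, st)] (pl', st')" and "tame (pl, st)" and "is_cirquent (pl', st')"
    and "pool_length pl < pool_length pl'" and "length st' \<le> length st"
  shows "tame (pl', st')"
proof (rule tameI)
  let ?L = "pool_length pl" and ?M = "pool_length pl'"
  show "length st' \<le> ?M" using assms(2,4,5) by (simp add: tame_def)
  show "provable_within (size_bound (pl, st) + cirquent_size (pl', st')) (pl', st')"
    using provable_within_rule[OF assms(1,3) tame_provable[OF assms(2)]] .
  \<comment> \<open>This is why the rank uses a cube: merging can destroy arcs, but there are at
    most \<open>?L^2\<close> of them, and raising the pool length by one raises the cube by more
    than that.\<close>
  have "(Suc ?L) ^ 3 \<le> ?M ^ 3" using assms(4) by (intro power_mono) auto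
  then have "?L ^ 3 + arcs st + 1 + 1 \<le> ?M ^ 3 + 1"
    using tame_arcs_le[OF assms(2)] by (simp add: power2_eq_square power3_eq_cube algebra_simps)
  then have step: "?L ^ 3 + arcs st + 1 + 1 \<le> ?M ^ 3 + arcs st' + 1" by simp
  have "block_bound ?L \<le> block_bound ?M" using assms(4) by (simp add: block_bound_mono)
  then have "(?L ^ 3 + arcs st + 1) * block_bound ?L + block_bound ?M \<le>
     (?L ^ 3 + arcs st + 1 + 1) * block_bound ?M"
    using mult_left_mono[of "block_bound ?L" "block_bound ?M" "?L ^ 3 + arcs st + 1"] by simp
  also have "(?L ^ 3 + arcs st + 1 + 1) * block_bound ?M \<le>
      (?M ^ 3 + arcs st' + 1) * block_bound ?M"
    using step by (rule mult_right_mono) simp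
  finally show "size_bound (pl, st) + block_bound ?M \<le> size_bound (pl', st')"
    by (simp add: size_bound_def)
qed (fact assms(3))

lemma tame_ogroup_subset: "tame (pl, st) \<Longrightarrow> \<forall>\<Gamma>\<in>set st. \<Gamma> \<subseteq> {..<length pl}"
  by (simp add: tame_def)

lemma tame_pool_weakening:
  assumes "tame (xs @ ys, st)"
  shows "tame (xs @ [F] @ ys, reindex (insert_pos (length xs)) st)"
proof (rule tame_pool_growth[OF pool_weakening assms])
  have ins: "insert_pos (length xs) ` {..<length (xs @ ys)} \<subseteq> {..<length (xs @ [F] @ ys)}"
    by (auto simp: insert_pos_def)
  show "is_cirquent (xs @ [F] @ ys, reindex (insert_pos (length xs)) st)"
    using reindex_subset[OF ins tame_ogroup_subset[OF assms]] by simp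
  show "pool_length (xs @ ys) < pool_length (xs @ [F] @ ys)"
    using formula_length_pos[of F] by (simp add: pool_length_def)
qed (simp add: reindex_def)

lemma merge_pos_subset:
  "merge_pos (length xs) ` {..<length (xs @ [F, G] @ ys)} \<subseteq> {..<length (xs @ [H] @ ys)}"
  by (auto simp: merge_pos_def)

lemma tame_disj_intro:
  assumes "tame (xs @ [F, G] @ ys, st)"
  shows "tame (xs @ [Disj F G] @ ys, reindex (merge_pos (length xs)) st)"
proof (rule tame_pool_growth[OF disj_intro assms])
  show "is_cirquent (xs @ [Disj F G] @ ys, reindex (merge_pos (length xs)) st)"
    unfolding is_cirquent.simps
    by (rule reindex_subset[OF merge_pos_subset tame_ogroup_subset[OF assms]])
qed (simp_all add: pool_length_def reindex_def)

lemma length_merge_ogroups: "length (merge_ogroups n st) \<le> length st"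
  by (induction n st rule: merge_ogroups.induct) auto

lemma merge_ogroups_subset:
  "\<forall>\<Gamma>\<in>set st. \<Gamma> \<subseteq> A \<Longrightarrow> \<forall>\<Gamma>\<in>set (merge_ogroups n st). \<Gamma> \<subseteq> A"
  by (induction n st rule: merge_ogroups.induct) auto

lemma tame_conj_intro:
  assumes "conj_ready (length xs) st" and "tame (xs @ [F, G] @ ys, st)"
  shows "tame (xs @ [Conj F G] @ ys,
     reindex (merge_pos (length xs)) (merge_ogroups (length xs) st))"
proof (rule tame_pool_growth[OF conj_intro[OF assms(1)] assms(2)])
  show "is_cirquent (xs @ [Conj F G] @ ys,
      reindex (merge_pos (length xs)) (merge_ogroups (length xs) st))"
    unfolding is_cirquent.simps
    by (rule reindex_subset[OF merge_pos_subset
          merge_ogroups_subset[OF tame_ogroup_subset[OF assms(2)]]])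
qed (simp_all add: pool_length_def reindex_def length_merge_ogroups)

text \<open>The pool stays fixed and the rank rises by exactly one, through the new arc.\<close>

lemma tame_ogroup_weakening:
  assumes "i < length pl" "i \<notin> \<Gamma>" and tame: "tame (pl, us @ [\<Gamma>] @ vs)"
  shows "tame (pl, us @ [insert i \<Gamma>] @ vs)"
proof (rule tameI)
  show C: "is_cirquent (pl, us @ [insert i \<Gamma>] @ vs)" using assms by (auto simp: tame_def)
  show "length (us @ [insert i \<Gamma>] @ vs) \<le> pool_length pl" using tame by (simp add: tame_def)
  show "provable_within
      (size_bound (pl, us @ [\<Gamma>] @ vs) + cirquent_size (pl, us @ [insert i \<Gamma>] @ vs))
      (pl, us @ [insert i \<Gamma>] @ vs)"
    using provable_within_rule[OF ogroup_weakening[OF assms(1,2)] C tame_provable[OF tame]] .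
  \<comment> \<open>Finiteness matters since \<open>card\<close> is 0 on infinite sets.\<close>
  have "finite \<Gamma>" using tame finite_subset by (auto simp: tame_def)
  then have "arcs (us @ [insert i \<Gamma>] @ vs) = arcs (us @ [\<Gamma>] @ vs) + 1"
    using assms(2) by (simp add: arcs_def)
  then show "size_bound (pl, us @ [\<Gamma>] @ vs) + block_bound (pool_length pl)
      \<le> size_bound (pl, us @ [insert i \<Gamma>] @ vs)"
    by (simp add: size_bound_def)
qed

lemma tame_mix:
  assumes "tame (pl1, st1)" and "tame (pl2, st2)"
  shows "tame (pl1 @ pl2, st1 @ reindex (\<lambda>i. length pl1 + i) st2)"
proof -
  let ?L = "pool_length pl1" and ?M = "pool_length pl2"
  let ?st = "st1 @ reindex (\<lambda>i. length pl1 + i) st2"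
  \<comment> \<open>An empty pool forces an empty structure by the bound on ogroups, so the
    conclusion then equals the other premise and no node is added. Otherwise the mixed terms of the
    cube are positive.\<close>
  consider "?L = 0" | "?M = 0" | "?L \<ge> 1" "?M \<ge> 1" by linarith
  then show ?thesis
  proof cases
    case 1
    then have "pl1 = []" "st1 = []"
      using length_le_pool_length[of pl1] assms(1) by (auto simp: tame_def)
    with assms(2) show ?thesis by (simp add: reindex_def)
  next
    case 2
    then have "pl2 = []" "st2 = []"
      using length_le_pool_length[of pl2] assms(2) by (auto simp: tame_def)
    with assms(1) show ?thesis by (simp add: reindex_def)
  next
    case 3
    have N: "pool_length (pl1 @ pl2) = ?L + ?M" by (simp add: pool_length_def)
    show ?thesis
    proof (rule tameI)
      show C: "is_cirquent (pl1 @ pl2, ?st)"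
        using assms by (auto simp: tame_def reindex_def subset_iff trans_less_add1)
      show "length ?st \<le> pool_length (pl1 @ pl2)"
        using assms by (simp add: tame_def reindex_def N)
      show "provable_within (size_bound (pl1, st1) + size_bound (pl2, st2) +
          cirquent_size (pl1 @ pl2, ?st)) (pl1 @ pl2, ?st)"
        using provable_within_mix[OF mix C tame_provable[OF assms(1)] tame_provable[OF assms(2)]] .
      let ?a = "?L ^ 3 + arcs st1 + 1" and ?b = "?M ^ 3 + arcs st2 + 1"
      \<comment> \<open>The mixed terms of \<open>(?L + ?M)^3\<close> absorb the arcs of both
        premises, the two constants and the unit for the new block.\<close>
      have "?L\<^sup>2 * 1 \<le> ?L\<^sup>2 * ?M" "1 * ?M\<^sup>2 \<le> ?L * ?M\<^sup>2" "1 \<le> ?L\<^sup>2 * ?M" "1 \<le> ?L * ?M\<^sup>2"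
        using 3 by (simp_all add: Suc_le_eq)
      moreover have "(?L + ?M) ^ 3 = ?L ^ 3 + ?M ^ 3 + 3 * (?L\<^sup>2 * ?M) + 3 * (?L * ?M\<^sup>2)"
        by (simp add: power2_eq_square power3_eq_cube algebra_simps)
      ultimately have "?L ^ 3 + ?L\<^sup>2 + ?M ^ 3 + ?M\<^sup>2 + 2 \<le> (?L + ?M) ^ 3"
        by linarith
      then have ab: "?a + ?b + 1 \<le> (?L + ?M) ^ 3 + arcs ?st + 1"
        using tame_arcs_le[OF assms(1)] tame_arcs_le[OF assms(2)] by simp
      have "?a * block_bound ?L + ?b * block_bound ?M + block_bound (?L + ?M)
          \<le> (?a + ?b + 1) * block_bound (?L + ?M)"
        using mult_left_mono[OF block_bound_mono[of ?L "?L + ?M"], of ?a]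
          mult_left_mono[OF block_bound_mono[of ?M "?L + ?M"], of ?b]
        by (simp add: distrib_right)
      also have "\<dots> \<le> ((?L + ?M) ^ 3 + arcs ?st + 1) * block_bound (?L + ?M)"
        using ab by (rule mult_right_mono) simp
      finally show "size_bound (pl1, st1) + size_bound (pl2, st2) +
          block_bound (pool_length (pl1 @ pl2)) \<le> size_bound (pl1 @ pl2, ?st)"
        by (simp add: size_bound_def N)
    qed
  qed
qed

lemma tame_axiom:
  assumes "CL5_rule [] (pl, st)" "is_cirquent (pl, st)" "length st \<le> pool_length pl"
  shows "tame (pl, st)"
  using assms provable_within_axiom[OF assms(1,2)]
  by (intro tameI[where n = 0]) (auto simp: size_bound_def)

lemma tame_rule: "CL5_rule Cs C \<Longrightarrow> \<forall>D\<in>set Cs. tame D \<Longrightarrow> tame C"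
proof (induction rule: CL5_rule.induct)
  case empty_axiom
  show ?case by (rule tame_axiom[OF CL5_rule.empty_axiom]) (simp_all add: pool_length_def)
next
  case (identity_axiom F)
  show ?case
    by (rule tame_axiom[OF CL5_rule.identity_axiom])
      (use formula_length_pos[of F] in \<open>auto simp: pool_length_def\<close>)
next
  case mix
  then show ?case by - (rule tame_mix, simp_all)
next
  case oformula_exchange
  then show ?case by - (rule tame_exchange[OF exchange.oformula], simp)
next
  case ogroup_exchange
  then show ?case by - (rule tame_exchange[OF exchange.ogroup], simp)
next
  case ogroup_weakening
  then show ?case by - (rule tame_ogroup_weakening, simp_all)
next
  case pool_weakening
  then show ?case by - (rule tame_pool_weakening, simp_all)
next
  case disj_intro
  then show ?case by - (rule tame_disj_intro, simp_all)
next
  case conj_intro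
  then show ?case by - (rule tame_conj_intro, simp_all)
qed

section \<open>From arbitrary proofs to polynomially bounded ones\<close>

lemma tame_conclusion: "is_CL5_proof t \<Longrightarrow> tame (conclusion t)"
proof (induction t)
  case (Node C ts)
  then have "CL5_rule (map conclusion ts) C" "\<forall>D\<in>set (map conclusion ts). tame D" by auto
  then show ?case by (simp only: proof_tree.sel tame_rule)
qed

theorem theorem3p4:
  shows "\<exists>p :: nat poly. \<forall>F :: formula. CL5_provable F \<longrightarrow>
           (\<exists>t. CL5_proof_of t F \<and> proof_size t \<le> poly p (formula_length F))"
proof -
  let ?X = "[:0, 1:] :: nat poly"
  \<comment> \<open>This is \<open>size_bound\<close> for a single-formula cirquent with
    \<open>?X\<close> as its length; the constant 2 is its one arc plus the 1 in the rank
    factor.\<close>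
  let ?p = "(?X ^ 3 + [:2:]) * (([:1:] + [:2:] * ?X\<^sup>2) * (?X + ?X\<^sup>2))"
  have "\<exists>t. CL5_proof_of t F \<and> proof_size t \<le> poly ?p (formula_length F)"
    if "CL5_provable F" for F
  proof -
    \<comment> \<open>The given proof may be arbitrarily large; only the tameness of its conclusion
      is kept, and this supplies the small proof.\<close>
    have "tame ([F], [{0}])"
      using that unfolding CL5_provable_def CL5_proof_of_def by (metis tame_conclusion)
    then have "provable_within (size_bound ([F], [{0}])) ([F], [{0}])" by (rule tame_provable)
    moreover have "size_bound ([F], [{0}]) = poly ?p (formula_length F)"
      by (simp add: size_bound_def block_bound_def pool_length_def arcs_def)
    ultimately show ?thesis
      unfolding provable_within_def CL5_proof_of_def by auto
  qed
  then show ?thesis by blast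
qed

end
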